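(* Let $0<\mu_1<\mu_2$, let $k\ge1$ and $m\ge1$ be integers, and let $h$ be proportional to $\gamma$, $h=\delta\gamma$ with $\delta>0$ fixed. Define, for $\gamma>0$, $$E(\gamma):=h^k\left(\frac{\rho}{c_0}\right)^m\frac1{c_0-\rho},$$ where $$c_0=\tfrac12\left((1+\gamma/\mu_2)^{-1}+(1+\gamma/\mu_1)^{-1}\right),\qquad \rho=\tfrac12\left((1+\gamma/\mu_2)^{-1}-(1+\gamma/\mu_1)^{-1}\right).$$ Then $$\frac{d\log E}{d\log\gamma}\ge k+1\qquad\text{for all }\gamma>0.$$
   Context: Here $\dfrac{d\log E}{d\log\gamma}=\gamma\,\dfrac{d}{d\gamma}\log E(\gamma)$. *)

theory Defs
  imports "HOL-Analysis.Analysis"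
begin

definition c0 :: "real \<Rightarrow> real \<Rightarrow> real \<Rightarrow> real" where
  "c0 \<mu>1 \<mu>2 \<gamma> = 1/2 * (inverse (1 + \<gamma> / \<mu>2) + inverse (1 + \<gamma> / \<mu>1))"

definition rho :: "real \<Rightarrow> real \<Rightarrow> real \<Rightarrow> real" where
  "rho \<mu>1 \<mu>2 \<gamma> = 1/2 * (inverse (1 + \<gamma> / \<mu>2) - inverse (1 + \<gamma> / \<mu>1))"

definition E :: "real \<Rightarrow> real \<Rightarrow> real \<Rightarrow> nat \<Rightarrow> nat \<Rightarrow> real \<Rightarrow> real" where
  "E \<mu>1 \<mu>2 \<delta> k m \<gamma> =
     (let h = \<delta> * \<gamma>
      in h ^ k * (rho \<mu>1 \<mu>2 \<gamma> / c0 \<mu>1 \<mu>2 \<gamma>) ^ m * (1 / (c0 \<mu>1 \<mu>2 \<gamma> - rho \<mu>1 \<mu>2 \<gamma>)))"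

(* d log F / d log x, i.e. x * (d/dx) log F(x).  Since deriv and ln are total, this is
   meaningful only where F is positive and ln o F is differentiable. *)
definition dlog_dlog :: "(real \<Rightarrow> real) \<Rightarrow> real \<Rightarrow> real" where
  "dlog_dlog F x = x * deriv (\<lambda>t. ln (F t)) x"

end

theory Submission
  imports Defs
begin

text \<open>
  The combinations of \<open>c0\<close> and \<open>rho\<close> that enter \<open>E\<close> are simple: \<open>c0 - rho = 1 / (1 + \<gamma> / \<mu>1)\<close>,
  and \<open>rho / c0\<close> is a fractional linear function of \<open>\<gamma>\<close> vanishing at \<open>0\<close>. Hence \<open>E\<close> is a product
  of integer powers of affine functions of \<open>\<gamma>\<close>, and its logarithmic slope is the sum
  \<open>k + m * (2 * \<mu>1 * \<mu>2) / (2 * \<mu>1 * \<mu>2 + (\<mu>1 + \<mu>2) * \<gamma>) + \<gamma> / (\<mu>1 + \<gamma>)\<close>.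
  The middle fraction, without its factor \<open>m\<close>, is at least \<open>\<mu>1 / (\<mu>1 + \<gamma>)\<close> because
  \<open>\<mu>1 + \<mu>2 \<le> 2 \<mu>2\<close>, so already with a single copy of it (\<open>m \<ge> 1\<close>) the last two terms add up
  to at least \<open>1\<close>. The lemmas that carry the argument are \<open>E_closed_form\<close> and
  \<open>slope_bound\<close>.
\<close>

lemma c0_minus_rho: "c0 \<mu>1 \<mu>2 \<gamma> - rho \<mu>1 \<mu>2 \<gamma> = inverse (1 + \<gamma> / \<mu>1)"
  by (simp add: c0_def rho_def algebra_simps)

lemma rho_div_c0:
  fixes \<mu>1 \<mu>2 \<gamma> :: real
  assumes "\<mu>1 > 0" "\<mu>2 > 0" "\<gamma> \<ge> 0"
  shows "rho \<mu>1 \<mu>2 \<gamma> / c0 \<mu>1 \<mu>2 \<gamma> = (\<mu>2 - \<mu>1) * \<gamma> / (2 * \<mu>1 * \<mu>2 + (\<mu>1 + \<mu>2) * \<gamma>)"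
proof -
  let ?D = "2 * (\<mu>1 + \<gamma>) * (\<mu>2 + \<gamma>)"
  have inv: "inverse (1 + \<gamma> / \<mu>) = \<mu> / (\<mu> + \<gamma>)" if "\<mu> > 0" for \<mu>
    using that by (simp add: field_simps)
  have pos: "\<mu>1 + \<gamma> > 0" "\<mu>2 + \<gamma> > 0"
    using assms by auto
  have "rho \<mu>1 \<mu>2 \<gamma> = (\<mu>2 - \<mu>1) * \<gamma> / ?D"
    unfolding rho_def inv[OF assms(1)] inv[OF assms(2)] using pos by (simp add: field_simps)
  moreover have "c0 \<mu>1 \<mu>2 \<gamma> = (2 * \<mu>1 * \<mu>2 + (\<mu>1 + \<mu>2) * \<gamma>) / ?D"
    unfolding c0_def inv[OF assms(1)] inv[OF assms(2)] using pos by (simp add: field_simps)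
  ultimately show ?thesis
    using pos by simp
qed

lemma E_closed_form:
  fixes \<mu>1 \<mu>2 \<delta> \<gamma> :: real
  assumes "\<mu>1 > 0" "\<mu>2 > 0" "\<gamma> \<ge> 0"
  shows "E \<mu>1 \<mu>2 \<delta> k m \<gamma> =
    (\<delta> * \<gamma>) ^ k * ((\<mu>2 - \<mu>1) * \<gamma> / (2 * \<mu>1 * \<mu>2 + (\<mu>1 + \<mu>2) * \<gamma>)) ^ m * (1 + \<gamma> / \<mu>1)"
  by (simp add: E_def Let_def c0_minus_rho rho_div_c0[OF assms] inverse_eq_divide)

lemma E_pos:
  assumes "0 < \<mu>1" "\<mu>1 < \<mu>2" "\<delta> > 0" "\<gamma> > 0"
  shows "E \<mu>1 \<mu>2 \<delta> k m \<gamma> > 0"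
proof -
  have "2 * \<mu>1 * \<mu>2 + (\<mu>1 + \<mu>2) * \<gamma> > 0" "1 + \<gamma> / \<mu>1 > 0"
    using assms by (auto intro!: add_pos_pos)
  then show ?thesis
    using assms by (simp add: E_closed_form)
qed

lemma ln_E:
  assumes "0 < \<mu>1" "\<mu>1 < \<mu>2" "\<delta> > 0" "\<gamma> > 0"
  shows "ln (E \<mu>1 \<mu>2 \<delta> k m \<gamma>) =
    real k * ln (\<delta> * \<gamma>)
    + real m * (ln ((\<mu>2 - \<mu>1) * \<gamma>) - ln (2 * \<mu>1 * \<mu>2 + (\<mu>1 + \<mu>2) * \<gamma>))
    + ln (1 + \<gamma> / \<mu>1)"
proof -
  have "2 * \<mu>1 * \<mu>2 + (\<mu>1 + \<mu>2) * \<gamma> > 0" "1 + \<gamma> / \<mu>1 > 0" "\<delta> * \<gamma> > 0" "(\<mu>2 - \<mu>1) * \<gamma> > 0"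
    using assms by (auto intro!: add_pos_pos)
  then show ?thesis
    using assms by (simp add: E_closed_form ln_mult_pos ln_div ln_realpow del: zero_less_mult_iff)
qed

lemma has_derivative_ln_E:
  assumes "0 < \<mu>1" "\<mu>1 < \<mu>2" "\<delta> > 0" "\<gamma> > 0"
  shows "((\<lambda>t. ln (E \<mu>1 \<mu>2 \<delta> k m t)) has_real_derivative
    real k / \<gamma>
    + real m * (1 / \<gamma> - (\<mu>1 + \<mu>2) / (2 * \<mu>1 * \<mu>2 + (\<mu>1 + \<mu>2) * \<gamma>))
    + 1 / (\<mu>1 + \<gamma>)) (at \<gamma>)"
proof (rule has_field_derivative_transform_within_open)
  have pos: "2 * \<mu>1 * \<mu>2 + (\<mu>1 + \<mu>2) * \<gamma> > 0" "1 + \<gamma> / \<mu>1 > 0"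
    using assms by (auto intro!: add_pos_pos)
  have scale: "(1 + \<gamma> / \<mu>1) * \<mu>1 = \<mu>1 + \<gamma>"
    using assms by (simp add: distrib_right)
  show "((\<lambda>t. real k * ln (\<delta> * t)
      + real m * (ln ((\<mu>2 - \<mu>1) * t) - ln (2 * \<mu>1 * \<mu>2 + (\<mu>1 + \<mu>2) * t))
      + ln (1 + t / \<mu>1)) has_real_derivative
    real k / \<gamma>
    + real m * (1 / \<gamma> - (\<mu>1 + \<mu>2) / (2 * \<mu>1 * \<mu>2 + (\<mu>1 + \<mu>2) * \<gamma>))
    + 1 / (\<mu>1 + \<gamma>)) (at \<gamma>)"
    using assms pos scale
    by (auto intro!: derivative_eq_intros simp: add_divide_distrib mult.commute)
  show "open {0::real<..}" "\<gamma> \<in> {0<..}"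
    using assms by auto
qed (use assms in \<open>simp add: ln_E\<close>)

text \<open>
  The right-hand side dominates the case \<open>m = 1\<close>, where subtracting \<open>\<gamma> / (\<mu>1 + \<gamma>)\<close> from both
  sides, clearing denominators and cancelling \<open>\<mu>1\<close> leaves \<open>(\<mu>1 + \<mu>2) \<gamma> \<le> 2 \<mu>2 \<gamma>\<close>.
\<close>

lemma slope_bound:
  fixes \<mu>1 \<mu>2 \<gamma> :: real
  assumes "0 < \<mu>1" "\<mu>1 \<le> \<mu>2" "\<gamma> \<ge> 0" "m \<ge> 1"
  shows "1 \<le> real m * (2 * \<mu>1 * \<mu>2 / (2 * \<mu>1 * \<mu>2 + (\<mu>1 + \<mu>2) * \<gamma>)) + \<gamma> / (\<mu>1 + \<gamma>)"
proof -
  let ?D = "2 * \<mu>1 * \<mu>2 + (\<mu>1 + \<mu>2) * \<gamma>"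
  have D: "?D > 0" and S: "\<mu>1 + \<gamma> > 0"
    using assms by (auto intro!: add_pos_nonneg)
  have "(\<mu>1 + \<mu>2) * \<gamma> \<le> 2 * \<mu>2 * \<gamma>"
    using assms by (intro mult_right_mono) auto
  then have "\<mu>1 * ?D \<le> \<mu>1 * (2 * \<mu>2 * (\<mu>1 + \<gamma>))"
    using assms by (intro mult_left_mono) (auto simp: algebra_simps)
  then have "\<mu>1 / (\<mu>1 + \<gamma>) \<le> 2 * \<mu>1 * \<mu>2 / ?D"
    using D S by (simp add: divide_le_eq le_divide_eq mult_ac)
  also have "\<dots> \<le> real m * (2 * \<mu>1 * \<mu>2 / ?D)"
    using mult_right_mono[of 1 "real m" "2 * \<mu>1 * \<mu>2 / ?D"] assms D by simp
  finally have "\<mu>1 / (\<mu>1 + \<gamma>) + \<gamma> / (\<mu>1 + \<gamma>) \<le> real m * (2 * \<mu>1 * \<mu>2 / ?D) + \<gamma> / (\<mu>1 + \<gamma>)"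
    by simp
  then show ?thesis
    using S by (simp add: add_divide_distrib[symmetric])
qed

lemma dlog_dlog_E:
  assumes "0 < \<mu>1" "\<mu>1 < \<mu>2" "\<delta> > 0" "\<gamma> > 0"
  shows "dlog_dlog (E \<mu>1 \<mu>2 \<delta> k m) \<gamma> =
    real k + real m * (2 * \<mu>1 * \<mu>2 / (2 * \<mu>1 * \<mu>2 + (\<mu>1 + \<mu>2) * \<gamma>)) + \<gamma> / (\<mu>1 + \<gamma>)"
proof -
  let ?D = "2 * \<mu>1 * \<mu>2 + (\<mu>1 + \<mu>2) * \<gamma>"
  have D: "?D > 0"
    using assms by (auto intro!: add_pos_pos)
  have "1 / \<gamma> - (\<mu>1 + \<mu>2) / ?D = 2 * \<mu>1 * \<mu>2 / ?D / \<gamma>"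
    using assms D by (simp add: diff_frac_eq)
  then have "dlog_dlog (E \<mu>1 \<mu>2 \<delta> k m) \<gamma> =
      \<gamma> * (real k / \<gamma> + real m * (2 * \<mu>1 * \<mu>2 / ?D / \<gamma>) + 1 / (\<mu>1 + \<gamma>))"
    unfolding dlog_dlog_def using DERIV_imp_deriv[OF has_derivative_ln_E[OF assms]] by simp
  also have "\<dots> = real k + real m * (2 * \<mu>1 * \<mu>2 / ?D) + \<gamma> / (\<mu>1 + \<gamma>)"
    using assms by (simp add: distrib_left)
  finally show ?thesis .
qed

theorem proposition2p15:
  fixes \<mu>1 \<mu>2 \<delta> :: real and k m :: nat
  assumes "0 < \<mu>1" and "\<mu>1 < \<mu>2" and "k \<ge> 1" and "m \<ge> 1" and "\<delta> > 0"
  shows "\<forall>\<gamma>>0. E \<mu>1 \<mu>2 \<delta> k m \<gamma> > 0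
           \<and> (\<lambda>t. ln (E \<mu>1 \<mu>2 \<delta> k m t)) differentiable (at \<gamma>)
           \<and> dlog_dlog (E \<mu>1 \<mu>2 \<delta> k m) \<gamma> \<ge> real k + 1"
proof (intro allI impI conjI)
  fix \<gamma> :: real
  assume \<gamma>: "\<gamma> > 0"
  note hyps = assms(1,2,5) \<gamma>
  show "E \<mu>1 \<mu>2 \<delta> k m \<gamma> > 0"
    using hyps by (rule E_pos)
  show "(\<lambda>t. ln (E \<mu>1 \<mu>2 \<delta> k m t)) differentiable (at \<gamma>)"
    using has_derivative_ln_E[OF hyps] by (auto simp: real_differentiable_def)
  show "dlog_dlog (E \<mu>1 \<mu>2 \<delta> k m) \<gamma> \<ge> real k + 1"
    using slope_bound[of \<mu>1 \<mu>2 \<gamma> m] assms \<gamma> by (simp add: dlog_dlog_E[OF hyps])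
qed

end
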